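(* Let $\lambda,\mu,\nu\in\mathbb{R}$ be pairwise distinct and $\mathfrak{p}=\{(\lambda,1),(\mu,2),(\nu,4)\}$. Then the set of block diagonal matrices $$\left\{\operatorname{diag}(\mu\mathbb{I}_2,D,\nu\mathbb{I}_3)\ \Big|\ D=R_\alpha^{-1}\begin{pmatrix}\lambda&0\\0&\nu\end{pmatrix}R_\alpha,\ \alpha\in\left[0,\tfrac{\pi}{2}\right]\right\}$$ is a cross-section for $\mathrm{Sym}_{\mathfrak{p}}/\mathcal{G}_2$.
   Context: $R_\alpha=\begin{pmatrix}\cos\alpha&-\sin\alpha\\ \sin\alpha&\cos\alpha\end{pmatrix}$; $\operatorname{diag}(\cdot)$ denotes the block diagonal matrix with the listed blocks. Let $V$ be a 7-dimensional Euclidean space with a vector product $\pi$, i.e. a linear map $\pi:V\wedge V\to V$ such that $\{u,v,\pi(u\wedge v)\}$ is orthonormal whenever $\{u,v\}\subset V$ is. Write $xy=\pi(x\wedge y)$. Let $\mathcal{G}_2=\mathrm{Aut}(\pi)$ be the group of all orthogonal linear maps $g:V\to V$ with $g(xy)=g(x)g(y)$ for all $x,y\in V$. A Cayley triple is a triple $(u,v,z)\in V^3$ such that $\{u,v,uv,z\}$ is orthonormal; it determines an orthonormal basis $(u,v,uv,z,uz,vz,(uv)z)$ of $V$. Fix a Cayley triple $s$, and for a symmetric endomorphism $\delta$ of $V$ let $[\delta]_s$ be its matrix in the basis determined by $s$; $\delta\mapsto[\delta]_s$ is a bijection $\mathrm{Sym}(V)\to\mathrm{Sym}(\mathbb{R}^7)$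 from symmetric endomorphisms of $V$ to real symmetric $7\times7$-matrices. $\mathcal{G}_2$ acts on $\mathrm{Sym}(\mathbb{R}^7)$ by $[\delta]_s\cdot g=[g^{-1}\delta g]_s$. For a symmetric matrix $\delta$ let $\mathfrak{p}(\delta)=\{(\lambda,\dim\mathcal{E}_\lambda(\delta))\mid\lambda\text{ an eigenvalue of }\delta\}$, where $\mathcal{E}_\lambda(\delta)$ is the eigenspace of $\lambda$, and for a set $\mathfrak{p}$ of such pairs let $\mathrm{Sym}_{\mathfrak{p}}=\{\delta\in\mathrm{Sym}(\mathbb{R}^7)\mid\mathfrak{p}(\delta)=\mathfrak{p}\}$, which is invariant under the action. A cross-section for $\mathrm{Sym}_{\mathfrak{p}}/\mathcal{G}_2$ is a subset of $\mathrm{Sym}_{\mathfrak{p}}$ containing exactly one element of each $\mathcal{G}_2$-orbit. $\mathbb{I}_n$ is the $n\times n$ identity matrix. *)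

theory Defs
  imports "HOL-Analysis.Analysis"
begin

definition orthonormal_family :: "'a::real_inner list \<Rightarrow> bool" where
  "orthonormal_family xs \<longleftrightarrow>
     (\<forall>i<length xs. \<forall>j<length xs. (xs ! i) \<bullet> (xs ! j) = (if i = j then 1 else 0))"

text \<open>A linear map on the exterior square of \<open>V\<close> is given as an alternating bilinear map on \<open>V\<close>.\<close>

definition vector_product :: "('a::euclidean_space \<Rightarrow> 'a \<Rightarrow> 'a) \<Rightarrow> bool" where
  "vector_product p \<longleftrightarrow>
     bilinear p \<and> (\<forall>x. p x x = 0) \<and>
     (\<forall>u v. orthonormal_family [u, v] \<longrightarrow> orthonormal_family [u, v, p u v])"

definition Aut_vp :: "('a::euclidean_space \<Rightarrow> 'a \<Rightarrow> 'a) \<Rightarrow> ('a \<Rightarrow> 'a) set" where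
  "Aut_vp p = {g. orthogonal_transformation g \<and> (\<forall>x y. g (p x y) = p (g x) (g y))}"

definition Cayley_triple ::
    "('a::euclidean_space \<Rightarrow> 'a \<Rightarrow> 'a) \<Rightarrow> 'a \<times> 'a \<times> 'a \<Rightarrow> bool" where
  "Cayley_triple p = (\<lambda>(u, v, z). orthonormal_family [u, v, p u v, z])"

text \<open>
  The constructor \<open>vector\<close> numbers components from 1, so in the index type \<open>7\<close> the last
  component has index \<open>7 = 0\<close>.
\<close>

definition Cayley_basis ::
    "('a::euclidean_space \<Rightarrow> 'a \<Rightarrow> 'a) \<Rightarrow> 'a \<times> 'a \<times> 'a \<Rightarrow> 'a ^ 7" where
  "Cayley_basis p = (\<lambda>(u, v, z). vector [u, v, p u v, z, p u z, p v z, p (p u v) z])"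

definition Sym_end :: "('a::euclidean_space \<Rightarrow> 'a) set" where
  "Sym_end = {\<delta>. linear \<delta> \<and> (\<forall>x y. \<delta> x \<bullet> y = x \<bullet> \<delta> y)}"

definition Sym_mat :: "(real ^ 'n ^ 'n) set" where
  "Sym_mat = {A. transpose A = A}"

text \<open>Column \<open>j\<close> consists of the coordinates of the image of the \<open>j\<close>-th basis vector.\<close>

definition matrix_wrt :: "'a::euclidean_space ^ 'n \<Rightarrow> ('a \<Rightarrow> 'a) \<Rightarrow> real ^ 'n ^ 'n" where
  "matrix_wrt b \<delta> = (\<chi> i j. representation (range (($) b)) (\<delta> (b $ j)) (b $ i))"

text \<open>
  The right action of \<open>Aut_vp p\<close> on symmetric matrices, transported from symmetric
  endomorphisms along the bijection \<open>matrix_wrt (Cayley_basis p s)\<close>.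
\<close>

definition sym_act ::
    "('a::euclidean_space \<Rightarrow> 'a \<Rightarrow> 'a) \<Rightarrow> 'a \<times> 'a \<times> 'a \<Rightarrow> real ^ 7 ^ 7 \<Rightarrow> ('a \<Rightarrow> 'a) \<Rightarrow> real ^ 7 ^ 7"
  where
  "sym_act p s A g =
     (let M = matrix_wrt (Cayley_basis p s); \<delta> = inv_into Sym_end M A
      in M (inv g \<circ> \<delta> \<circ> g))"

definition orbit_of :: "('x \<Rightarrow> 'g \<Rightarrow> 'x) \<Rightarrow> 'g set \<Rightarrow> 'x \<Rightarrow> 'x set" where
  "orbit_of act G x = {act x g | g. g \<in> G}"

definition cross_section :: "('x \<Rightarrow> 'g \<Rightarrow> 'x) \<Rightarrow> 'g set \<Rightarrow> 'x set \<Rightarrow> 'x set \<Rightarrow> bool" where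
  "cross_section act G X C \<longleftrightarrow>
     C \<subseteq> X \<and> (\<forall>\<O>\<in>orbit_of act G ` X. \<exists>!c. c \<in> C \<and> c \<in> \<O>)"

definition eigenspace :: "real ^ 'n ^ 'n \<Rightarrow> real \<Rightarrow> (real ^ 'n) set" where
  "eigenspace A l = {x. A *v x = l *\<^sub>R x}"

definition is_eigenvalue :: "real ^ 'n ^ 'n \<Rightarrow> real \<Rightarrow> bool" where
  "is_eigenvalue A l \<longleftrightarrow> (\<exists>x. x \<noteq> 0 \<and> A *v x = l *\<^sub>R x)"

definition eigen_pairs :: "real ^ 'n ^ 'n \<Rightarrow> (real \<times> nat) set" where
  "eigen_pairs A = {(l, dim (eigenspace A l)) | l. is_eigenvalue A l}"

definition Sym_pairs :: "(real \<times> nat) set \<Rightarrow> (real ^ 7 ^ 7) set" where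
  "Sym_pairs P = {A \<in> Sym_mat. eigen_pairs A = P}"

definition rot :: "real \<Rightarrow> real ^ 2 ^ 2" where
  "rot \<alpha> = vector [vector [cos \<alpha>, - sin \<alpha>], vector [sin \<alpha>, cos \<alpha>]]"

definition block_diag :: "real ^ 2 ^ 2 \<Rightarrow> real ^ 2 ^ 2 \<Rightarrow> real ^ 3 ^ 3 \<Rightarrow> real ^ 7 ^ 7" where
  "block_diag A B C = vector
    [vector [A$1$1, A$1$2, 0,     0,     0,     0,     0],
     vector [A$2$1, A$2$2, 0,     0,     0,     0,     0],
     vector [0,     0,     B$1$1, B$1$2, 0,     0,     0],
     vector [0,     0,     B$2$1, B$2$2, 0,     0,     0],
     vector [0,     0,     0,     0,     C$1$1, C$1$2, C$1$3],
     vector [0,     0,     0,     0,     C$2$1, C$2$2, C$2$3],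
     vector [0,     0,     0,     0,     C$3$1, C$3$2, C$3$3]]"

end

theory Submission
  imports Defs
begin

text \<open>
  Write \<open>xy\<close> for the vector product. A symmetric map \<open>\<delta>\<close> with eigenvalues \<open>l\<close>, \<open>\<mu>\<close>, \<open>\<nu>\<close> of
  multiplicities 1, 2, 4 is determined by a unit vector \<open>x\<close> of its \<open>l\<close>-eigenspace and an orthonormal
  basis \<open>u, v\<close> of its \<open>\<mu>\<close>-eigenspace: it is
  \<open>w \<mapsto> \<nu> w + (l - \<nu>) (w \<bullet> x) x + (\<mu> - \<nu>) ((w \<bullet> u) u + (w \<bullet> v) v)\<close>
  (\<open>spectral_map\<close>, \<open>spectral_map_exists\<close>). The vector \<open>x\<close> is unique up to sign, and so is \<open>uv\<close>, because
  replacing \<open>u, v\<close> by another orthonormal basis of the same plane multiplies \<open>uv\<close> by a determinant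
  \<open>\<plusminus>1\<close>. The angle \<open>\<alpha>\<close> between the lines spanned by \<open>x\<close> and by \<open>uv\<close> therefore depends on \<open>\<delta>\<close>
  alone and does not change under automorphisms; the point is that there is no other invariant.

  To see this, choose the sign of \<open>x\<close> such that \<open>x \<bullet> uv \<ge> 0\<close>. Since \<open>x\<close> is orthogonal to \<open>u\<close> and
  \<open>v\<close>, it can be written \<open>x = cos \<alpha> uv - sin \<alpha> z\<close> with \<open>z\<close> a unit vector orthogonal to \<open>u\<close>, \<open>v\<close>
  and \<open>uv\<close>. Then \<open>(u, v, z)\<close> is a Cayley triple, and in its basis the matrix of \<open>\<delta>\<close> is exactly the
  block matrix with angle \<open>\<alpha>\<close> (\<open>adapted_Cayley_triple_exists\<close>, \<open>matrix_wrt_spectral_map\<close>).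

  What links bases to the group action is that the products of the members of a Cayley basis are given
  by the same table for every Cayley triple (\<open>Cayley_products\<close>), so that the isometry that carries one
  Cayley basis to another is an automorphism (\<open>Aut_transitive_on_Cayley_triples\<close>). Hence the orbit of
  the matrix of \<open>\<delta>\<close> consists of the matrices of \<open>\<delta>\<close> in all Cayley bases (\<open>orbit_sym_act\<close>).
  Existence of a representative is then the normal form above, and uniqueness is invariance of the
  angle (\<open>adapted_angle_unique\<close>).
\<close>

section \<open>Orthonormal families and vectors with seven components\<close>

lemma orthonormal_family_Nil [simp]: "orthonormal_family []"
  by (simp add: orthonormal_family_def)

lemma orthonormal_family_Cons [simp]:
  "orthonormal_family (x # xs) \<longleftrightarrow>
     x \<bullet> x = 1 \<and> (\<forall>y\<in>set xs. x \<bullet> y = 0) \<and> orthonormal_family xs"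
  unfolding orthonormal_family_def length_Cons All_less_Suc2
  by (auto simp: all_set_conv_all_nth inner_commute)

lemma exhaust_7:
  fixes i :: 7
  shows "i = 1 \<or> i = 2 \<or> i = 3 \<or> i = 4 \<or> i = 5 \<or> i = 6 \<or> i = 7"
proof (induct i)
  case (of_int z)
  then have "z = 0 \<or> z = 1 \<or> z = 2 \<or> z = 3 \<or> z = 4 \<or> z = 5 \<or> z = 6" by fastforce
  then show ?case by auto
qed

lemma forall_7: "(\<forall>i::7. P i) \<longleftrightarrow> P 1 \<and> P 2 \<and> P 3 \<and> P 4 \<and> P 5 \<and> P 6 \<and> P 7"
  by (metis exhaust_7)

text \<open>
  The component with index 0 is included because the index \<open>7 = 0\<close> may occur in either form.
\<close>

lemma vector_7:
  "(vector [a, b, c, d, e, f, g] :: 'a::zero^7) $ 1 = a"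
  "(vector [a, b, c, d, e, f, g] :: 'a::zero^7) $ 2 = b"
  "(vector [a, b, c, d, e, f, g] :: 'a::zero^7) $ 3 = c"
  "(vector [a, b, c, d, e, f, g] :: 'a::zero^7) $ 4 = d"
  "(vector [a, b, c, d, e, f, g] :: 'a::zero^7) $ 5 = e"
  "(vector [a, b, c, d, e, f, g] :: 'a::zero^7) $ 6 = f"
  "(vector [a, b, c, d, e, f, g] :: 'a::zero^7) $ 7 = g"
  "(vector [a, b, c, d, e, f, g] :: 'a::zero^7) $ 0 = g"
  unfolding vector_def by simp_all

section \<open>Algebra of a vector product\<close>

locale vector_product_space =
  fixes p :: "'a::euclidean_space \<Rightarrow> 'a \<Rightarrow> 'a"
  assumes vp: "vector_product p"
begin

lemma bilinear_p: "bilinear p"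
  using vp by (simp add: vector_product_def)

lemmas p_simps =
  bilinear_ladd[OF bilinear_p] bilinear_radd[OF bilinear_p]
  bilinear_lmul[OF bilinear_p] bilinear_rmul[OF bilinear_p]
  bilinear_lneg[OF bilinear_p] bilinear_rneg[OF bilinear_p]
  bilinear_lsub[OF bilinear_p] bilinear_rsub[OF bilinear_p]
  bilinear_lzero[OF bilinear_p] bilinear_rzero[OF bilinear_p]

lemma p_self [simp]: "p x x = 0"
  using vp by (simp add: vector_product_def)

lemma p_anticommute: "p y x = - p x y"
proof -
  have "p (x + y) (x + y) = p x y + p y x"
    by (simp add: bilinear_ladd[OF bilinear_p] bilinear_radd[OF bilinear_p] del: p_self) simp
  then show ?thesis
    by (simp add: eq_neg_iff_add_eq_0 add.commute)
qed

text \<open>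
  The axiom only speaks of orthonormal pairs. Gram-Schmidt writes \<open>x = a e\<close> and \<open>y = b e + c f\<close> with
  \<open>e, f\<close> orthonormal, and then \<open>p x y\<close> is \<open>a c\<close> times the unit vector \<open>p e f\<close>. If \<open>y\<close> is a multiple
  of \<open>x\<close> there is no \<open>f\<close>, but then \<open>p x y = 0\<close>.
\<close>

lemma p_gram:
  shows p_orth_left: "p x y \<bullet> x = 0"
    and p_orth_right: "p x y \<bullet> y = 0"
    and p_norm: "p x y \<bullet> p x y = (x \<bullet> x) * (y \<bullet> y) - (x \<bullet> y)\<^sup>2"
proof -
  let ?G = "\<lambda>x y. p x y \<bullet> x = 0 \<and> p x y \<bullet> y = 0 \<and>
    p x y \<bullet> p x y = (x \<bullet> x) * (y \<bullet> y) - (x \<bullet> y)\<^sup>2"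
  have "?G x y"
  proof (cases "x = 0")
    case True
    then show ?thesis by (simp add: p_simps)
  next
    case False
    define e where "e = x /\<^sub>R norm x"
    define w where "w = y - (y \<bullet> e) *\<^sub>R e"
    have x: "x = norm x *\<^sub>R e" and e: "e \<bullet> e = 1"
      using False by (simp_all add: e_def dot_square_norm power2_eq_square)
    have y: "y = (y \<bullet> e) *\<^sub>R e + w" and ew: "e \<bullet> w = 0"
      using e by (simp_all add: w_def inner_diff_right inner_commute)
    have main: "?G (a *\<^sub>R e) (b *\<^sub>R e + w)" for a b
    proof (cases "w = 0")
      case True
      then show ?thesis
        using e by (simp add: p_simps power2_eq_square)
    next
      case False
      define f where "f = w /\<^sub>R norm w"
      have w: "w = norm w *\<^sub>R f" and f: "f \<bullet> f = 1" and ef: "e \<bullet> f = 0"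
        using False ew by (simp_all add: f_def dot_square_norm power2_eq_square)
      have "orthonormal_family [e, f, p e f]"
        using vp e f ef by (auto simp: vector_product_def)
      then have pef: "p e f \<bullet> p e f = 1" "p e f \<bullet> e = 0" "p e f \<bullet> f = 0"
        by (auto simp: inner_commute)
      have "?G (a *\<^sub>R e) (b *\<^sub>R e + c *\<^sub>R f)" for c
        using e f ef pef
        by (simp add: p_simps inner_add_right inner_commute[of f e] power2_eq_square
            algebra_simps)
      from this[of "norm w"] show ?thesis
        using w by simp
    qed
    show ?thesis
      using main[of "norm x" "y \<bullet> e"] by (simp only: x[symmetric] y[symmetric])
  qed
  then show "p x y \<bullet> x = 0" "p x y \<bullet> y = 0"
      "p x y \<bullet> p x y = (x \<bullet> x) * (y \<bullet> y) - (x \<bullet> y)\<^sup>2"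
    by auto
qed

text \<open>
  Polarisation of \<open>p x y \<bullet> y = 0\<close>. With anticommutativity it makes \<open>p x y \<bullet> z\<close> alternating in its
  three arguments.
\<close>

lemma p_triple_swap: "p x y \<bullet> z = - (p x z \<bullet> y)"
proof -
  have "p x (y + z) \<bullet> (y + z) = p x y \<bullet> z + p x z \<bullet> y"
    by (simp add: bilinear_radd[OF bilinear_p] inner_add_right inner_add_left p_orth_right)
  then show ?thesis
    by (simp add: p_orth_right)
qed

lemma p_polar: "p x y \<bullet> p x w = (x \<bullet> x) * (y \<bullet> w) - (x \<bullet> y) * (x \<bullet> w)"
proof -
  have "p x (y + w) \<bullet> p x (y + w) = p x y \<bullet> p x y + 2 * (p x y \<bullet> p x w) + p x w \<bullet> p x w"
    by (simp add: bilinear_radd[OF bilinear_p] inner_add_right inner_add_left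
        inner_commute[of "p x w" "p x y"])
  then show ?thesis
    unfolding p_norm
    by (simp add: inner_add_right inner_add_left inner_commute[of w y] power2_eq_square
        algebra_simps)
qed

text \<open>
  The adjoint of \<open>p x\<close> is \<open>- p x\<close>, so that \<open>p x (p x y) \<bullet> w = - (p x y \<bullet> p x w)\<close>, which the polarised
  norm identity evaluates.
\<close>

lemma p_double: "p x (p x y) = (x \<bullet> y) *\<^sub>R x - (x \<bullet> x) *\<^sub>R y"
proof -
  have "p x (p x y) \<bullet> w = ((x \<bullet> y) *\<^sub>R x - (x \<bullet> x) *\<^sub>R y) \<bullet> w" for w
    using p_triple_swap[of x "p x y" w] p_polar[of x w y]
    by (simp add: inner_diff_left inner_diff_right inner_commute algebra_simps)
  then show ?thesis
    using vector_eq_rdot by blast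
qed

lemma p_double_polar:
  "p x (p y w) + p y (p x w) = (x \<bullet> w) *\<^sub>R y + (y \<bullet> w) *\<^sub>R x - (2 * (x \<bullet> y)) *\<^sub>R w"
proof -
  have "p x (p y w) + p y (p x w) = p (x + y) (p (x + y) w) - p x (p x w) - p y (p y w)"
    by (simp add: p_simps)
  also have "\<dots> = (x \<bullet> w) *\<^sub>R y + (y \<bullet> w) *\<^sub>R x - (2 * (x \<bullet> y)) *\<^sub>R w"
    unfolding p_double
    by (simp add: inner_add_right inner_add_left inner_commute[of y x] algebra_simps)
  finally show ?thesis .
qed

text \<open>
  Polarising the formula for \<open>p x (p x w)\<close> in \<open>x\<close> gives the anticommutator of \<open>p x\<close> and \<open>p y\<close>, whose
  terms vanish on an orthogonal triple. It replaces associativity in all computations with Cayley bases.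
\<close>

lemma p_swap_orthogonal:
  assumes "x \<bullet> y = 0" "x \<bullet> w = 0" "y \<bullet> w = 0"
  shows "p x (p y w) = - p y (p x w)"
  using p_double_polar[of x y w] assms by (simp add: eq_neg_iff_add_eq_0)

lemma p_double_orthonormal:
  assumes "x \<bullet> x = 1" "x \<bullet> y = 0"
  shows "p x (p x y) = - y" "p (p x y) x = y"
  using p_double[of x y] assms by (simp_all add: p_anticommute[of "p x y" x])

text \<open>
  Right multiplication by \<open>z\<close> preserves inner products on the complement of \<open>z\<close>, so the span of
  \<open>u, v, uv\<close> is carried isometrically to that of \<open>uz, vz, (uv)z\<close>. The two are orthogonal because
  \<open>az \<bullet> c = - (ac \<bullet> z)\<close> and \<open>z\<close> is orthogonal to all products of \<open>u, v, uv\<close>.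
\<close>

lemma Cayley_inner:
  assumes "Cayley_triple p (u, v, z)"
  shows "\<forall>i j. Cayley_basis p (u, v, z) $ i \<bullet> Cayley_basis p (u, v, z) $ j = (if i = j then 1 else 0)"
proof -
  have o: "u \<bullet> u = 1" "v \<bullet> v = 1" "z \<bullet> z = 1" "u \<bullet> v = 0" "u \<bullet> z = 0" "v \<bullet> z = 0"
      "p u v \<bullet> z = 0" "v \<bullet> u = 0" "z \<bullet> u = 0" "z \<bullet> v = 0" "z \<bullet> p u v = 0"
    using assms by (auto simp: Cayley_triple_def inner_commute)
  have o3: "p u v \<bullet> p u v = 1" "u \<bullet> p u v = 0" "v \<bullet> p u v = 0" "p u v \<bullet> u = 0" "p u v \<bullet> v = 0"
    using p_norm[of u v] p_orth_left[of u v] p_orth_right[of u v] o by (auto simp: inner_commute)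
  have o7: "p u z \<bullet> p u z = 1" "p v z \<bullet> p v z = 1" "p (p u v) z \<bullet> p (p u v) z = 1"
    using p_norm[of u z] p_norm[of v z] p_norm[of "p u v" z] o o3 by auto
  have *: "p a z \<bullet> p c z = a \<bullet> c" if "a \<bullet> z = 0" for a c
    using p_polar[of z a c] that o(3)
    by (simp add: p_anticommute[of _ z] p_simps inner_commute)
  have **: "p a z \<bullet> c = 0" if "p a c \<bullet> z = 0" for a c
    using p_triple_swap[of a c z] that by simp
  have uc: "p (p u v) u = v" "p (p u v) v = - u"
    using p_double_orthonormal(2)[of u v] p_double_orthonormal(2)[of v u] o
    by (simp_all add: p_anticommute[of u v] p_simps)
  have vu: "p v u \<bullet> z = 0"
    using o by (simp add: p_anticommute[of v u])
  have ou: "p v (p u v) \<bullet> z = 0" "p u (p u v) \<bullet> z = 0"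
     using uc o by (simp_all add: p_anticommute[of _ "p u v"])
  have k: "p u z \<bullet> v = 0" "p u z \<bullet> p u v = 0" "p v z \<bullet> u = 0" "p v z \<bullet> p u v = 0"
      "p (p u v) z \<bullet> u = 0" "p (p u v) z \<bullet> v = 0"
    by (rule **, simp add: uc vu ou o o3)+
  have k': "p u z \<bullet> p v z = 0" "p u z \<bullet> p (p u v) z = 0" "p v z \<bullet> p (p u v) z = 0"
    using o o3 by (simp_all add: *)
  have k'': "p a z \<bullet> a = 0" "p a z \<bullet> z = 0" for a
    by (rule p_orth_left p_orth_right)+
  show ?thesis
    unfolding forall_7 Cayley_basis_def
    using o o3 o7 k k' k'' by (simp add: vector_7 inner_commute)
qed

text \<open>
  The multiplication table of the imaginary octonions above the diagonal. That it does not depend on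
  the triple is what makes all Cayley triples equivalent under automorphisms.
\<close>

lemma Cayley_products:
  assumes "Cayley_triple p (u, v, z)"
  shows "p u (p u v) = - v" "p u (p u z) = - z" "p u (p v z) = - p (p u v) z"
    "p u (p (p u v) z) = p v z"
    "p v (p u v) = u" "p v (p u z) = p (p u v) z" "p v (p v z) = - z"
    "p v (p (p u v) z) = - p u z"
    "p (p u v) (p u z) = - p v z" "p (p u v) (p v z) = p u z" "p (p u v) (p (p u v) z) = - z"
    "p z (p u z) = u" "p z (p v z) = v" "p z (p (p u v) z) = p u v"
    "p (p u z) (p v z) = - p u v" "p (p u z) (p (p u v) z) = v" "p (p v z) (p (p u v) z) = - u"
proof -
  note orth = Cayley_inner[OF assms, unfolded forall_7 Cayley_basis_def prod.case vector_7]
  show 0: "p u (p u v) = - v" "p u (p u z) = - z" "p v (p v z) = - z"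
      "p (p u v) (p (p u v) z) = - z"
    using orth p_double_orthonormal by auto
  show v3: "p v (p u v) = u"
    using p_double_orthonormal[of v u] orth by (simp add: p_anticommute[of v u] p_simps)
  show z: "p z (p u z) = u" "p z (p v z) = v" "p z (p (p u v) z) = p u v"
    using p_double_orthonormal(1)[of z] orth by (simp_all add: p_anticommute[of _ z] p_simps)
  show uvz: "p u (p v z) = - p (p u v) z"
    using p_swap_orthogonal[of u z v] orth
    by (simp add: p_anticommute[of v z] p_anticommute[of "p u v" z] p_simps)
  show vuz: "p v (p u z) = p (p u v) z"
    using p_swap_orthogonal[of u v z] uvz orth by simp
  show u7: "p u (p (p u v) z) = p v z"
    using p_double_orthonormal[of u "p v z"] uvz orth by (simp add: p_simps)
  show v7: "p v (p (p u v) z) = - p u z"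
    using p_double_orthonormal[of v "p u z"] vuz orth by simp
  show "p (p u v) (p u z) = - p v z"
    using p_swap_orthogonal[of u "p u v" z] u7 orth by simp
  show "p (p u v) (p v z) = p u z"
    using p_swap_orthogonal[of v "p u v" z] v7 orth by simp
  have "- p (p u z) (p v z) = p u v"
    using p_swap_orthogonal[of "p u z" z v] z vuz orth
    by (simp add: p_anticommute[of "p u z" v] p_anticommute[of z v] p_simps)
  then show "p (p u z) (p v z) = - p u v"
    by (metis minus_minus)
  show "p (p u z) (p (p u v) z) = v"
    using p_double_orthonormal(1)[of "p u z" v] vuz orth
    by (simp add: p_anticommute[of "p u z" v] p_simps)
  show "p (p v z) (p (p u v) z) = - u"
    using p_double_orthonormal(1)[of "p v z" u] uvz orth
    by (simp add: p_anticommute[of "p v z" u] p_simps)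
qed

end

section \<open>Coordinates in an orthonormal basis\<close>

text \<open>
  The cardinality clause turns an orthonormal family into a basis.
\<close>

definition orthonormal_basis :: "'a::euclidean_space ^ 'n \<Rightarrow> bool" where
  "orthonormal_basis b \<longleftrightarrow>
     CARD('n) = DIM('a) \<and> (\<forall>i j. b $ i \<bullet> b $ j = (if i = j then 1 else 0))"

definition combination :: "'a::real_vector ^ 'n \<Rightarrow> real ^ 'n \<Rightarrow> 'a" where
  "combination b x = (\<Sum>i\<in>UNIV. (x $ i) *\<^sub>R b $ i)"

definition coords :: "'a::real_inner ^ 'n \<Rightarrow> 'a \<Rightarrow> real ^ 'n" where
  "coords b w = (\<chi> i. w \<bullet> b $ i)"

lemma linear_combination: "linear (combination b)"
  by (rule linearI) (simp_all add: combination_def scaleR_left_distrib sum.distrib scaleR_sum_right)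

lemma linear_coords: "linear (coords b)"
  by (rule linearI) (simp_all add: coords_def vec_eq_iff inner_add_left)

context
  fixes b :: "'a::euclidean_space ^ 'n"
  assumes b: "orthonormal_basis b"
begin

lemma basis_inner: "b $ i \<bullet> b $ j = (if i = j then 1 else 0)"
  using b by (simp add: orthonormal_basis_def)

lemma basis_inj: "inj (($) b)"
proof (rule injI)
  fix i j assume "b $ i = b $ j"
  then show "i = j"
    using basis_inner[of i j] basis_inner[of j j] by (auto split: if_splits)
qed

lemma basis_independent: "independent (range (($) b))"
proof (rule pairwise_orthogonal_independent)
  show "pairwise orthogonal (range (($) b))"
    by (auto simp: pairwise_def orthogonal_def basis_inner)
  show "0 \<notin> range (($) b)"
    using basis_inner by (metis imageE inner_zero_left zero_neq_one)
qed

lemma basis_span: "span (range (($) b)) = UNIV"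
proof -
  have "dim (range (($) b)) = DIM('a)"
    using b basis_inj
    by (simp add: dim_eq_card_independent[OF basis_independent] card_image orthonormal_basis_def)
  then show ?thesis
    by (simp add: dim_eq_full)
qed

lemma coords_combination: "coords b (combination b x) = x"
  by (simp add: coords_def combination_def inner_sum_left basis_inner vec_eq_iff if_distrib
      cong: if_cong)

lemma combination_coords: "combination b (coords b w) = w"
proof -
  have "(combination b (coords b w) - w) \<bullet> x = 0" for x
  proof -
    have "x \<in> span (range (($) b))"
      by (simp add: basis_span)
    then have "orthogonal (combination b (coords b w) - w) x"
    proof (rule orthogonal_to_span)
      fix y assume "y \<in> range (($) b)"
      then obtain i where "y = b $ i" by auto
      then show "orthogonal (combination b (coords b w) - w) y"
        by (simp add: orthogonal_def coords_def combination_def inner_diff_left inner_sum_left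
            basis_inner if_distrib cong: if_cong)
    qed
    then show ?thesis
      by (simp add: orthogonal_def)
  qed
  then show ?thesis
    by (metis inner_eq_zero_iff right_minus_eq)
qed

lemma basis_expansion: "w = (\<Sum>i\<in>UNIV. (w \<bullet> b $ i) *\<^sub>R b $ i)"
  using combination_coords[of w] by (simp add: combination_def coords_def)

lemma coords_inner: "coords b x \<bullet> coords b y = x \<bullet> y"
proof -
  have "x \<bullet> y = (\<Sum>i\<in>UNIV. (x \<bullet> b $ i) *\<^sub>R b $ i) \<bullet> y"
    using basis_expansion[of x] by simp
  then show ?thesis
    by (simp add: inner_sum_left inner_vec_def coords_def inner_commute[of y])
qed

lemma representation_orthonormal_basis: "representation (range (($) b)) w (b $ i) = w \<bullet> b $ i"
proof -
  have "representation (range (($) b)) w = (\<lambda>v. if v \<in> range (($) b) then w \<bullet> v else 0)"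
  proof (rule representation_eqI[OF basis_independent])
    have fin: "finite (range (($) b))" by simp
    show "w \<in> span (range (($) b))" by (simp add: basis_span)
    show "v \<in> range (($) b)" if "(if v \<in> range (($) b) then w \<bullet> v else 0) \<noteq> 0" for v
      using that by (simp split: if_splits)
    show "finite {v. (if v \<in> range (($) b) then w \<bullet> v else 0) \<noteq> 0}"
      by (rule finite_subset[OF _ fin]) auto
    have "(\<Sum>v | (if v \<in> range (($) b) then w \<bullet> v else 0) \<noteq> 0.
             (if v \<in> range (($) b) then w \<bullet> v else 0) *\<^sub>R v) =
          (\<Sum>v\<in>range (($) b). (w \<bullet> v) *\<^sub>R v)"
      by (rule sum.mono_neutral_cong_left) auto
    also have "\<dots> = (\<Sum>i\<in>UNIV. (w \<bullet> b $ i) *\<^sub>R b $ i)"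
      by (subst sum.reindex[OF basis_inj]) simp
    also have "\<dots> = w"
      using basis_expansion[of w] by simp
    finally show "(\<Sum>v | (if v \<in> range (($) b) then w \<bullet> v else 0) \<noteq> 0.
             (if v \<in> range (($) b) then w \<bullet> v else 0) *\<^sub>R v) = w" .
  qed
  then show ?thesis by simp
qed

lemma matrix_wrt_nth: "matrix_wrt b \<delta> $ i $ j = \<delta> (b $ j) \<bullet> b $ i"
  by (simp add: matrix_wrt_def representation_orthonormal_basis)

lemma matrix_wrt_coords:
  assumes "linear \<delta>"
  shows "matrix_wrt b \<delta> *v coords b w = coords b (\<delta> w)"
proof -
  have "\<delta> w = (\<Sum>j\<in>UNIV. (w \<bullet> b $ j) *\<^sub>R \<delta> (b $ j))"
    by (subst basis_expansion[of w]) (simp add: linear_sum[OF assms] linear_scale[OF assms])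
  then show ?thesis
    by (simp add: vec_eq_iff matrix_vector_mult_def matrix_wrt_nth coords_def inner_sum_left
        mult.commute)
qed

lemma eigenspace_matrix_wrt:
  assumes "linear \<delta>"
  shows "eigenspace (matrix_wrt b \<delta>) t = coords b ` {w. \<delta> w = t *\<^sub>R w}"
proof (intro set_eqI iffI)
  fix x assume "x \<in> eigenspace (matrix_wrt b \<delta>) t"
  then have "coords b (\<delta> (combination b x)) = t *\<^sub>R x"
    using matrix_wrt_coords[OF assms, of "combination b x"]
    by (simp add: coords_combination eigenspace_def)
  then have "\<delta> (combination b x) = t *\<^sub>R combination b x"
    using combination_coords[of "\<delta> (combination b x)"] by (simp add: linear_scale[OF linear_combination])
  then show "x \<in> coords b ` {w. \<delta> w = t *\<^sub>R w}"
    by (intro image_eqI[of _ _ "combination b x"]) (simp_all add: coords_combination)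
next
  fix x assume "x \<in> coords b ` {w. \<delta> w = t *\<^sub>R w}"
  then show "x \<in> eigenspace (matrix_wrt b \<delta>) t"
    using matrix_wrt_coords[OF assms]
    by (auto simp: eigenspace_def linear_scale[OF linear_coords])
qed

lemma dim_eigenspace_matrix_wrt:
  assumes "linear \<delta>"
  shows "dim (eigenspace (matrix_wrt b \<delta>) t) = dim {w. \<delta> w = t *\<^sub>R w}"
  unfolding eigenspace_matrix_wrt[OF assms]
proof (rule dim_image_eq[OF linear_coords])
  show "inj_on (coords b) (span {w. \<delta> w = t *\<^sub>R w})"
    by (metis combination_coords inj_on_inverseI)
qed

lemma matrix_wrt_inj_on: "inj_on (matrix_wrt b) Sym_end"
proof (rule inj_onI)
  fix \<delta> \<epsilon> :: "'a \<Rightarrow> 'a"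
  assume "\<delta> \<in> Sym_end" "\<epsilon> \<in> Sym_end" and eq: "matrix_wrt b \<delta> = matrix_wrt b \<epsilon>"
  then have lin: "linear \<delta>" "linear \<epsilon>"
    by (simp_all add: Sym_end_def)
  show "\<delta> = \<epsilon>"
  proof
    fix w
    show "\<delta> w = \<epsilon> w"
      using eq matrix_wrt_coords[OF lin(1), of w] matrix_wrt_coords[OF lin(2), of w]
      by (metis combination_coords)
  qed
qed

text \<open>
  With \<open>matrix_wrt_inj_on\<close> this says that a symmetric matrix is the matrix of exactly one symmetric map;
  the action \<open>sym_act\<close> is defined through that map.
\<close>

lemma Sym_mat_matrix_wrtE:
  assumes "A \<in> Sym_mat"
  obtains \<delta> where "\<delta> \<in> Sym_end" "matrix_wrt b \<delta> = A"
proof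
  let ?\<delta> = "\<lambda>w. combination b (A *v coords b w)"
  have adj: "combination b x \<bullet> y = x \<bullet> coords b y" for x y
    by (metis coords_combination coords_inner)
  have adj': "x \<bullet> combination b y = coords b x \<bullet> y" for x y
    by (metis coords_combination coords_inner)
  have lin: "linear ?\<delta>"
    using linear_compose[OF linear_compose[OF linear_coords matrix_vector_mul_linear]
        linear_combination, of b A b] by (simp add: o_def)
  have sym: "(A *v x) \<bullet> y = x \<bullet> (A *v y)" for x y
    using assms dot_lmul_matrix[of x A y] transpose_matrix_vector[of A x]
    by (simp add: Sym_mat_def)
  show "?\<delta> \<in> Sym_end"
    using lin by (simp add: Sym_end_def adj adj' sym)
  show "matrix_wrt b ?\<delta> = A"
  proof -
    have "matrix_wrt b ?\<delta> *v x = A *v x" for x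
      using matrix_wrt_coords[OF lin, of "combination b x"] by (simp add: coords_combination)
    then show ?thesis
      by (simp add: matrix_eq)
  qed
qed

end

lemma orthonormal_basis_map:
  fixes b b' :: "'a::euclidean_space ^ 'n"
  assumes b: "orthonormal_basis b" and b': "orthonormal_basis b'"
  obtains g where "orthogonal_transformation g" "\<And>i. g (b $ i) = b' $ i"
proof
  let ?g = "combination b' \<circ> coords b"
  have "combination b' x \<bullet> combination b' y = x \<bullet> y" for x y
    using coords_inner[OF b', of "combination b' x" "combination b' y"]
    by (simp add: coords_combination[OF b'])
  then show "orthogonal_transformation ?g"
    by (simp add: orthogonal_transformation_def linear_compose linear_coords linear_combination
        coords_inner[OF b])
  show "?g (b $ i) = b' $ i" for i
    by (simp add: combination_def coords_def basis_inner[OF b] if_distrib[of "\<lambda>r. r *\<^sub>R _"]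
        cong: if_cong)
qed

text \<open>
  Acting on \<open>\<delta>\<close> by an isometry amounts to changing the basis in which the matrix of \<open>\<delta>\<close> is taken.
\<close>

lemma matrix_wrt_conjugate:
  fixes b b' :: "'a::euclidean_space ^ 'n"
  assumes b: "orthonormal_basis b" and b': "orthonormal_basis b'"
    and g: "orthogonal_transformation g" "\<And>i. g (b $ i) = b' $ i"
  shows "matrix_wrt b (inv g \<circ> \<delta> \<circ> g) = matrix_wrt b' \<delta>"
proof -
  have "inv g (\<delta> (b' $ j)) \<bullet> b $ i = \<delta> (b' $ j) \<bullet> b' $ i" for i j
  proof -
    have "inv g (\<delta> (b' $ j)) \<bullet> b $ i = g (inv g (\<delta> (b' $ j))) \<bullet> g (b $ i)"
      using g(1) by (simp add: orthogonal_transformation_def)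
    then show ?thesis
      using orthogonal_transformation_surj[OF g(1)] by (simp add: g(2) surj_f_inv_f)
  qed
  then show ?thesis
    by (simp add: vec_eq_iff matrix_wrt_nth[OF b] matrix_wrt_nth[OF b'] g(2))
qed

section \<open>Symmetric maps with eigenspaces of dimension one, two and codimension three\<close>

text \<open>
  For orthonormal \<open>x, u, v\<close> this is the symmetric map that is \<open>l\<close> on the line of \<open>x\<close>, \<open>\<mu>\<close> on the
  plane of \<open>u, v\<close> and \<open>\<nu>\<close> on the orthogonal complement of both. The formula mentions no basis of
  the \<open>\<nu>\<close>-eigenspace, so none has to be chosen.
\<close>

definition spectral_map ::
    "real \<Rightarrow> real \<Rightarrow> real \<Rightarrow> 'a::euclidean_space \<Rightarrow> 'a \<Rightarrow> 'a \<Rightarrow> 'a \<Rightarrow> 'a" where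
  "spectral_map l \<mu> \<nu> x u v w =
     \<nu> *\<^sub>R w + ((l - \<nu>) * (w \<bullet> x)) *\<^sub>R x
       + ((\<mu> - \<nu>) * (w \<bullet> u)) *\<^sub>R u + ((\<mu> - \<nu>) * (w \<bullet> v)) *\<^sub>R v"

lemma spectral_map_Sym_end: "spectral_map l \<mu> \<nu> x u v \<in> Sym_end"
proof -
  have "linear (spectral_map l \<mu> \<nu> x u v)"
    by (rule linearI) (simp_all add: spectral_map_def algebra_simps inner_add_left)
  then show ?thesis
    by (simp add: Sym_end_def spectral_map_def inner_add_left inner_add_right inner_commute
        algebra_simps)
qed

lemma spectral_map_uminus: "spectral_map l \<mu> \<nu> (- x) u v = spectral_map l \<mu> \<nu> x u v"
  by (simp add: spectral_map_def fun_eq_iff)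

lemma span_pair: "w \<in> span {u, v} \<longleftrightarrow> (\<exists>a b. w = a *\<^sub>R u + b *\<^sub>R v)"
proof -
  have "w \<in> span {u, v} \<longleftrightarrow> (\<exists>a b. w - a *\<^sub>R u = b *\<^sub>R v)"
    by (simp add: span_insert[of u "{v}"] span_singleton image_iff)
  also have "\<dots> \<longleftrightarrow> (\<exists>a b. w = a *\<^sub>R u + b *\<^sub>R v)"
    by (simp add: diff_eq_eq add.commute)
  finally show ?thesis .
qed

lemma dim_orthonormal:
  assumes "orthonormal_family xs"
  shows "dim (set xs) = length xs"
proof -
  have "distinct xs"
    using assms by (auto simp: distinct_conv_nth orthonormal_family_def)
      (metis zero_neq_one)
  moreover have "independent (set xs)"
  proof (rule pairwise_orthogonal_independent)
    show "pairwise orthogonal (set xs)"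
      using assms by (auto simp: pairwise_def orthogonal_def in_set_conv_nth orthonormal_family_def)
    show "0 \<notin> set xs"
      using assms by (auto simp: in_set_conv_nth orthonormal_family_def)
        (metis inner_zero_left zero_neq_one)
  qed
  ultimately show ?thesis
    by (simp add: dim_eq_card_independent distinct_card)
qed

lemma dim_orthogonal_complement:
  fixes xs :: "'a::euclidean_space list"
  assumes "orthonormal_family xs"
  shows "dim {w. \<forall>x\<in>set xs. w \<bullet> x = 0} + length xs = DIM('a)"
proof -
  have "{w. \<forall>x\<in>set xs. w \<bullet> x = 0} = {w \<in> UNIV. \<forall>x\<in>span (set xs). orthogonal x w}"
    by (auto simp: orthogonal_commute orthogonal_def[symmetric] span_base intro: orthogonal_to_span)
  then show ?thesis
    using dim_subspace_orthogonal_to_vectors[of "span (set xs)" "UNIV :: 'a set"]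
      dim_orthonormal[OF assms]
    by (simp add: subspace_span)
qed

text \<open>
  Taking inner products of the eigenvalue equation with \<open>x, u, v\<close> shows that the components of \<open>w\<close>
  along those of them whose eigenvalue is not \<open>t\<close> vanish; the equation itself then determines \<open>w\<close>.
\<close>

lemma spectral_map_eigenspace:
  assumes "orthonormal_family [x, u, v]" and "l \<noteq> \<mu>" "l \<noteq> \<nu>" "\<mu> \<noteq> \<nu>"
  shows "{w. spectral_map l \<mu> \<nu> x u v w = t *\<^sub>R w} =
    (if t = l then span {x} else if t = \<mu> then span {u, v}
     else if t = \<nu> then {w. \<forall>y\<in>set [x, u, v]. w \<bullet> y = 0} else {0})" (is "?E = ?R")
proof
  have o: "x \<bullet> x = 1" "u \<bullet> u = 1" "v \<bullet> v = 1" "x \<bullet> u = 0" "x \<bullet> v = 0" "u \<bullet> v = 0"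
    "u \<bullet> x = 0" "v \<bullet> x = 0" "v \<bullet> u = 0"
    using assms(1) by (auto simp: inner_commute)
  show "?R \<subseteq> ?E"
    using o by (auto simp: spectral_map_def span_pair span_singleton inner_add_left algebra_simps
        split: if_splits)
  show "?E \<subseteq> ?R"
  proof
    fix w assume "w \<in> ?E"
    then have eq: "\<nu> *\<^sub>R w + ((l - \<nu>) * (w \<bullet> x)) *\<^sub>R x
       + ((\<mu> - \<nu>) * (w \<bullet> u)) *\<^sub>R u + ((\<mu> - \<nu>) * (w \<bullet> v)) *\<^sub>R v = t *\<^sub>R w"
      by (simp add: spectral_map_def)
    have x: "(t - l) * (w \<bullet> x) = 0" and u: "(t - \<mu>) * (w \<bullet> u) = 0" and v: "(t - \<mu>) * (w \<bullet> v) = 0"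
      using arg_cong[OF eq, of "\<lambda>y. y \<bullet> x"] arg_cong[OF eq, of "\<lambda>y. y \<bullet> u"]
        arg_cong[OF eq, of "\<lambda>y. y \<bullet> v"] o
      by (auto simp: inner_add_left algebra_simps)
    have w: "(t - \<nu>) *\<^sub>R w = ((l - \<nu>) * (w \<bullet> x)) *\<^sub>R x
       + (((\<mu> - \<nu>) * (w \<bullet> u)) *\<^sub>R u + ((\<mu> - \<nu>) * (w \<bullet> v)) *\<^sub>R v)"
      using eq by (simp add: algebra_simps)
    consider "t = l" | "t = \<mu>" | "t = \<nu>" | "t \<noteq> l" "t \<noteq> \<mu>" "t \<noteq> \<nu>"
      by blast
    then show "w \<in> ?R"
    proof cases
      case 1
      then have "(l - \<nu>) *\<^sub>R w = (l - \<nu>) *\<^sub>R ((w \<bullet> x) *\<^sub>R x)"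
        using w u v assms by simp
      then have "w = (w \<bullet> x) *\<^sub>R x"
        using assms by (simp only: scaleR_cancel_left) simp
      then show ?thesis
        using 1 by (auto simp: span_singleton)
    next
      case 2
      then have "(\<mu> - \<nu>) *\<^sub>R w = (\<mu> - \<nu>) *\<^sub>R ((w \<bullet> u) *\<^sub>R u + (w \<bullet> v) *\<^sub>R v)"
        using w x assms by (simp add: scaleR_add_right)
      then have "w = (w \<bullet> u) *\<^sub>R u + (w \<bullet> v) *\<^sub>R v"
        using assms by (simp only: scaleR_cancel_left) simp
      then show ?thesis
        using 2 assms by (auto simp: span_pair)
    next
      case 3
      then show ?thesis
        using x u v assms by simp
    next
      case 4
      then show ?thesis
        using w x u v by simp
    qed
  qed
qed

lemma spectral_map_dim:
  fixes x u v :: "'a::euclidean_space"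
  assumes "orthonormal_family [x, u, v]" and "l \<noteq> \<mu>" "l \<noteq> \<nu>" "\<mu> \<noteq> \<nu>"
  shows "dim {w. spectral_map l \<mu> \<nu> x u v w = t *\<^sub>R w} =
    (if t = l then 1 else if t = \<mu> then 2 else if t = \<nu> then DIM('a) - 3 else 0)"
  unfolding spectral_map_eigenspace[OF assms]
  using dim_orthonormal[of "[x]"] dim_orthonormal[of "[u, v]"] assms(1)
    dim_orthogonal_complement[OF assms(1)]
  by (auto simp: numeral_eq_Suc)

text \<open>
  Eigenspaces of different eigenvalues are orthogonal, so the \<open>\<nu>\<close>-eigenspace lies in the complement of
  \<open>x, u, v\<close>; the dimension hypothesis forces equality.
\<close>

lemma spectral_map_exists:
  fixes \<delta> :: "'a::euclidean_space \<Rightarrow> 'a"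
  assumes "\<delta> \<in> Sym_end" and ne: "l \<noteq> \<mu>" "l \<noteq> \<nu>" "\<mu> \<noteq> \<nu>"
    and diml: "dim {w. \<delta> w = l *\<^sub>R w} = 1" and dim\<mu>: "dim {w. \<delta> w = \<mu> *\<^sub>R w} = 2"
    and dim\<nu>: "dim {w. \<delta> w = \<nu> *\<^sub>R w} + 3 = DIM('a)"
  obtains x u v where "orthonormal_family [x, u, v]" "\<delta> = spectral_map l \<mu> \<nu> x u v"
proof -
  have lin: "linear \<delta>" and sym: "\<delta> x \<bullet> y = x \<bullet> \<delta> y" for x y
    using assms(1) by (auto simp: Sym_end_def)
  have sub: "subspace {w. \<delta> w = t *\<^sub>R w}" for t
    by (auto simp: subspace_def linear_0[OF lin] linear_add[OF lin] linear_scale[OF lin]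
        scaleR_add_right mult.commute)
  have orth: "y \<bullet> z = 0" if "\<delta> y = s *\<^sub>R y" "\<delta> z = t *\<^sub>R z" "s \<noteq> t" for y z s t
    using sym[of y z] that by simp
  obtain B where B: "B \<subseteq> {w. \<delta> w = l *\<^sub>R w}" "\<And>x. x \<in> B \<Longrightarrow> norm x = 1" "card B = 1"
    by (rule orthonormal_basis_subspace[OF sub[of l]]) (auto simp: diml)
  from B(3) obtain x where "B = {x}"
    by (rule card_1_singletonE)
  with B have x: "\<delta> x = l *\<^sub>R x" "norm x = 1"
    by auto
  obtain C where C: "C \<subseteq> {w. \<delta> w = \<mu> *\<^sub>R w}" "\<And>x. x \<in> C \<Longrightarrow> norm x = 1" "card C = 2"
      "pairwise orthogonal C"
    by (rule orthonormal_basis_subspace[OF sub[of \<mu>]]) (auto simp: dim\<mu>)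
  then obtain u v where "C = {u, v}" "u \<noteq> v"
    by (meson card_2_iff)
  with C have uv: "\<delta> u = \<mu> *\<^sub>R u" "\<delta> v = \<mu> *\<^sub>R v" "norm u = 1" "norm v = 1" "u \<bullet> v = 0"
    by (auto simp: pairwise_def orthogonal_def)
  have xuv: "x \<bullet> u = 0" "x \<bullet> v = 0"
    using orth[OF x(1) uv(1) ne(1)] orth[OF x(1) uv(2) ne(1)] by simp_all
  have on: "orthonormal_family [x, u, v]"
    using x uv xuv by (simp add: dot_square_norm)
  let ?K = "{w. \<forall>y\<in>set [x, u, v]. w \<bullet> y = 0}"
  have subK: "subspace ?K"
    by (auto simp: subspace_def inner_add_left)
  have "{w. \<delta> w = \<nu> *\<^sub>R w} \<subseteq> ?K"
    using orth[OF _ x(1), of _ \<nu>] orth[OF _ uv(1), of _ \<nu>] orth[OF _ uv(2), of _ \<nu>] ne by auto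
  then have K: "{w. \<delta> w = \<nu> *\<^sub>R w} = ?K"
    using subspace_dim_equal[OF sub subK] dim\<nu> dim_orthogonal_complement[OF on] by simp
  have "\<delta> w = spectral_map l \<mu> \<nu> x u v w" for w
  proof -
    let ?k = "w - (w \<bullet> x) *\<^sub>R x - (w \<bullet> u) *\<^sub>R u - (w \<bullet> v) *\<^sub>R v"
    have "?k \<in> ?K"
      using on by (auto simp: inner_diff_left inner_diff_right inner_commute)
    then have k: "\<delta> ?k = \<nu> *\<^sub>R ?k"
      using K by blast
    have "\<delta> ?k = \<delta> w - (l * (w \<bullet> x)) *\<^sub>R x - (\<mu> * (w \<bullet> u)) *\<^sub>R u - (\<mu> * (w \<bullet> v)) *\<^sub>R v"
      by (simp add: linear_diff[OF lin] linear_scale[OF lin] x(1) uv(1,2) mult.commute)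
    from trans[OF this[symmetric] k] show ?thesis
      by (simp add: spectral_map_def algebra_simps)
  qed
  then show ?thesis
    using that on by blast
qed

lemma is_eigenvalue_iff_dim: "is_eigenvalue A t \<longleftrightarrow> dim (eigenspace A t) \<noteq> 0"
  by (auto simp: is_eigenvalue_def eigenspace_def dim_eq_0)

text \<open>
  Eigenspaces of dimension 0 are those of numbers that are not eigenvalues, so the set of pairs carries
  the same information as the dimension function, which is easier to transport between bases.
\<close>

lemma eigen_pairs_iff:
  assumes "l \<noteq> \<mu>" "l \<noteq> \<nu>" "\<mu> \<noteq> \<nu>" "a \<noteq> 0" "b \<noteq> 0" "c \<noteq> 0"
  shows "eigen_pairs A = {(l, a), (\<mu>, b), (\<nu>, c)} \<longleftrightarrow>
    (\<forall>t. dim (eigenspace A t) = (if t = l then a else if t = \<mu> then b else if t = \<nu> then c else 0))"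
    (is "?L \<longleftrightarrow> ?R")
proof -
  have *: "(t, d) \<in> eigen_pairs A \<longleftrightarrow> d \<noteq> 0 \<and> dim (eigenspace A t) = d" for t d
    unfolding eigen_pairs_def is_eigenvalue_iff_dim by blast
  show ?thesis
  proof
    assume L: ?L
    show ?R
    proof
      fix t
      have "(t, d) \<in> {(l, a), (\<mu>, b), (\<nu>, c)} \<longleftrightarrow> d \<noteq> 0 \<and> dim (eigenspace A t) = d" for d
        using *[of t d] L by simp
      from this[of a] this[of b] this[of c] this[of "dim (eigenspace A t)"]
      show "dim (eigenspace A t) = (if t = l then a else if t = \<mu> then b else if t = \<nu> then c else 0)"
        using assms by auto
    qed
  next
    assume R: ?R
    show ?L
      using assms by (auto simp: * R split: if_splits)
  qed
qed

lemma matrix_inv_rot: "matrix_inv (rot \<alpha>) = vector [vector [cos \<alpha>, sin \<alpha>], vector [- sin \<alpha>, cos \<alpha>]]"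
    (is "_ = ?B")
proof -
  have "rot \<alpha> ** ?B = mat 1" "?B ** rot \<alpha> = mat 1"
    by (simp_all add: rot_def matrix_matrix_mult_def mat_def vec_eq_iff forall_2 sum_2
        power2_eq_square[symmetric])
  moreover have "A = ?B" if "A ** rot \<alpha> = mat 1" "rot \<alpha> ** ?B = mat 1" for A
  proof -
    have "A = A ** (rot \<alpha> ** ?B)"
      by (simp add: that(2))
    also have "\<dots> = ?B"
      by (simp add: matrix_mul_assoc that(1))
    finally show ?thesis .
  qed
  ultimately show ?thesis
    unfolding matrix_inv_def by (intro some_equality) blast+
qed

text \<open>
  Conjugating by \<open>rot \<alpha>\<close> makes the rows of \<open>rot \<alpha>\<close> the eigenvectors of the middle block, and the first
  row, which belongs to \<open>l\<close>, is \<open>(cos \<alpha>, - sin \<alpha>)\<close>.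
\<close>

lemma matrix_wrt_spectral_map:
  fixes b :: "'a::euclidean_space ^ 7"
  assumes b: "orthonormal_basis b"
  shows "matrix_wrt b (spectral_map l \<mu> \<nu> (cos \<alpha> *\<^sub>R b $ 3 - sin \<alpha> *\<^sub>R b $ 4) (b $ 1) (b $ 2)) =
    block_diag (\<mu> *\<^sub>R mat 1)
      (matrix_inv (rot \<alpha>) ** vector [vector [l, 0], vector [0, \<nu>]] ** rot \<alpha>) (\<nu> *\<^sub>R mat 1)"
proof -
  have cs: "r * (cos \<alpha> * cos \<alpha>) + r * (sin \<alpha> * sin \<alpha>) = r" for r
    using sin_cos_squared_add3[of \<alpha>] by (metis distrib_left mult.right_neutral)
  show ?thesis
    unfolding vec_eq_iff forall_7 matrix_inv_rot
    by (simp add: matrix_wrt_nth[OF b] spectral_map_def block_diag_def vector_7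
       inner_add_left inner_diff_right inner_diff_left basis_inner[OF b]
       rot_def matrix_matrix_mult_def sum_2 mat_def algebra_simps cs)
qed

section \<open>Cayley triples and orbits\<close>

context vector_product_space
begin

lemma Cayley_orthonormal_basis:
  assumes "DIM('a) = 7" "Cayley_triple p s"
  shows "orthonormal_basis (Cayley_basis p s)"
  using assms Cayley_inner by (cases s) (simp add: orthonormal_basis_def)

text \<open>
  Bilinearity reduces multiplicativity of the isometry to pairs of basis vectors, where both sides are
  read off the same multiplication table.
\<close>

lemma Aut_transitive_on_Cayley_triples:
  assumes "DIM('a) = 7" "Cayley_triple p s" "Cayley_triple p s'"
  obtains g where "g \<in> Aut_vp p" "\<And>i. g (Cayley_basis p s $ i) = Cayley_basis p s' $ i"
proof -
  let ?b = "Cayley_basis p s" and ?b' = "Cayley_basis p s'"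
  have basis: "orthonormal_basis ?b" "orthonormal_basis ?b'"
    using assms Cayley_orthonormal_basis by blast+
  obtain g where g: "orthogonal_transformation g" "\<And>i. g (?b $ i) = ?b' $ i"
    using orthonormal_basis_map[OF basis] by metis
  have lin: "linear g"
    using g(1) by (simp add: orthogonal_transformation_linear)
  \<comment> \<open>The table lists products above the diagonal only; anticommutativity supplies the rest.\<close>
  define P where "P i j \<longleftrightarrow> g (p (?b $ i) (?b $ j)) = p (?b' $ i) (?b' $ j)" for i j
  have P_self: "P i i" for i
    by (simp add: P_def linear_0[OF lin])
  have P_swap: "P i j \<Longrightarrow> P j i" for i j
    unfolding P_def p_anticommute[of "?b $ j"] p_anticommute[of "?b' $ j"]
    by (simp add: linear_neg[OF lin])
  obtain u v z u' v' z' where s: "s = (u, v, z)" "s' = (u', v', z')"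
    by (metis prod.exhaust)
  have "\<forall>i. g (?b $ i) = ?b' $ i"
    using g(2) by blast
  note images = this[unfolded s forall_7 Cayley_basis_def prod.case vector_7]
  have less: "P 1 2" "P 1 3" "P 1 4" "P 1 5" "P 1 6" "P 1 7" "P 2 3" "P 2 4" "P 2 5" "P 2 6" "P 2 7"
    "P 3 4" "P 3 5" "P 3 6" "P 3 7" "P 4 5" "P 4 6" "P 4 7" "P 5 6" "P 5 7" "P 6 7"
    unfolding P_def s Cayley_basis_def prod.case vector_7
    using images Cayley_products[OF assms(2)[unfolded s]] Cayley_products[OF assms(3)[unfolded s]]
    by (simp_all add: linear_neg[OF lin])
  have all: "P i j" for i j
  proof -
    have "\<forall>i j. P i j"
      unfolding forall_7 using less less[THEN P_swap] P_self by simp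
    then show ?thesis by blast
  qed
  have "g (p x y) = p (g x) (g y)" for x y
  proof (rule bilinear_eq[where f = "\<lambda>x y. g (p x y)" and g = "\<lambda>x y. p (g x) (g y)"])
    show "bilinear (\<lambda>x y. g (p x y))" "bilinear (\<lambda>x y. p (g x) (g y))"
      unfolding bilinear_def
      by (auto intro!: linearI simp: p_simps linear_add[OF lin] linear_scale[OF lin])
    show "UNIV \<subseteq> span (range (($) ?b))" "UNIV \<subseteq> span (range (($) ?b))"
      using basis_span[OF basis(1)] by simp_all
    show "g (p c d) = p (g c) (g d)" if "c \<in> range (($) ?b)" "d \<in> range (($) ?b)" for c d
      using that all by (auto simp: P_def g(2))
  qed auto
  then have "g \<in> Aut_vp p"
    using g(1) by (simp add: Aut_vp_def)
  then show ?thesis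
    using g(2) that by blast
qed

lemma Aut_Cayley_triple:
  assumes "g \<in> Aut_vp p" "Cayley_triple p s"
  obtains s' where "Cayley_triple p s'" "\<And>i. g (Cayley_basis p s $ i) = Cayley_basis p s' $ i"
proof -
  obtain u v z where s: "s = (u, v, z)"
    by (metis prod.exhaust)
  have hom: "g (p x y) = p (g x) (g y)" and inner: "g x \<bullet> g y = x \<bullet> y" for x y
    using assms(1) by (auto simp: Aut_vp_def orthogonal_transformation_def)
  have "Cayley_triple p (g u, g v, g z)"
    using assms(2) by (simp add: s Cayley_triple_def inner hom[symmetric])
  moreover have "\<forall>i. g (Cayley_basis p (u, v, z) $ i) = Cayley_basis p (g u, g v, g z) $ i"
    unfolding forall_7 by (simp add: Cayley_basis_def vector_7 hom)
  ultimately show ?thesis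
    using that s by blast
qed

text \<open>
  The group acts on bases instead of maps: as the group element varies, the image of the Cayley basis
  of \<open>s\<close> runs through all Cayley bases.
\<close>

lemma orbit_sym_act:
  assumes dim: "DIM('a) = 7" and s: "Cayley_triple p s" and \<delta>: "\<delta> \<in> Sym_end"
  shows "orbit_of (sym_act p s) (Aut_vp p) (matrix_wrt (Cayley_basis p s) \<delta>) =
    {matrix_wrt (Cayley_basis p s') \<delta> | s'. Cayley_triple p s'}"
proof -
  note basis = Cayley_orthonormal_basis[OF dim]
  let ?M = "\<lambda>s. matrix_wrt (Cayley_basis p s)"
  have "inv_into Sym_end (?M s) (?M s \<delta>) = \<delta>"
    by (rule inv_into_f_f[OF matrix_wrt_inj_on[OF basis[OF s]] \<delta>])
  then have act: "sym_act p s (?M s \<delta>) g = ?M s (inv g \<circ> \<delta> \<circ> g)" for g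
    by (simp add: sym_act_def Let_def)
  have conj: "?M s (inv g \<circ> \<delta> \<circ> g) = ?M s' \<delta>"
    if "g \<in> Aut_vp p" "Cayley_triple p s'" "\<And>i. g (Cayley_basis p s $ i) = Cayley_basis p s' $ i"
    for g s'
    using that by (intro matrix_wrt_conjugate basis s) (auto simp: Aut_vp_def)
  show ?thesis
  proof (intro set_eqI iffI)
    fix A assume "A \<in> orbit_of (sym_act p s) (Aut_vp p) (?M s \<delta>)"
    then obtain g where g: "g \<in> Aut_vp p" "A = ?M s (inv g \<circ> \<delta> \<circ> g)"
      by (auto simp: orbit_of_def act)
    obtain s' where "Cayley_triple p s'" "\<And>i. g (Cayley_basis p s $ i) = Cayley_basis p s' $ i"
      using Aut_Cayley_triple[OF g(1) s] by metis
    then show "A \<in> {?M s' \<delta> | s'. Cayley_triple p s'}"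
      using conj g by blast
  next
    fix A assume "A \<in> {?M s' \<delta> | s'. Cayley_triple p s'}"
    then obtain s' where s': "Cayley_triple p s'" "A = ?M s' \<delta>"
      by blast
    obtain g where g: "g \<in> Aut_vp p" "\<And>i. g (Cayley_basis p s $ i) = Cayley_basis p s' $ i"
      using Aut_transitive_on_Cayley_triples[OF dim s s'(1)] by metis
    have "A = sym_act p s (?M s \<delta>) g"
      using conj[OF g(1) s'(1) g(2)] s'(2) act by simp
    then show "A \<in> orbit_of (sym_act p s) (Aut_vp p) (?M s \<delta>)"
      using g(1) by (auto simp: orbit_of_def)
  qed
qed

end

section \<open>Invariance and normalisation of the angle\<close>

context vector_product_space
begin

text \<open>
  In coordinates the product changes by the determinant of the change of basis, and it keeps norm 1.
\<close>

lemma p_orthonormal_pair_of_plane: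
  assumes "orthonormal_family [u, v]" "orthonormal_family [u', v']"
    and "u' \<in> span {u, v}" "v' \<in> span {u, v}"
  shows "p u' v' = p u v \<or> p u' v' = - p u v"
proof -
  obtain a b c d where ab: "u' = a *\<^sub>R u + b *\<^sub>R v" and cd: "v' = c *\<^sub>R u + d *\<^sub>R v"
    using assms(3,4) by (auto simp: span_pair)
  have eq: "p u' v' = (a * d - b * c) *\<^sub>R p u v"
    unfolding ab cd by (simp add: p_simps p_anticommute[of v u] algebra_simps)
  have "p u v \<bullet> p u v = 1" "p u' v' \<bullet> p u' v' = 1"
    using assms(1,2) by (simp_all add: p_norm)
  then have "(a * d - b * c)\<^sup>2 = 1"
    unfolding eq by (simp add: power2_eq_square)
  then have "a * d - b * c = 1 \<or> a * d - b * c = - 1"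
    by (simp add: power2_eq_1_iff)
  then show ?thesis
    unfolding eq by auto
qed

text \<open>
  The eigenvector for \<open>l\<close> of the block matrix with angle \<open>\<alpha>\<close>, read in the Cayley basis of
  \<open>(u, v, z)\<close>.
\<close>

definition adapted_axis :: "'a \<Rightarrow> 'a \<Rightarrow> 'a \<Rightarrow> real \<Rightarrow> 'a" where
  "adapted_axis u v z \<alpha> = cos \<alpha> *\<^sub>R p u v - sin \<alpha> *\<^sub>R z"

lemma adapted_axis_orthonormal:
  assumes "Cayley_triple p (u, v, z)"
  shows "orthonormal_family [adapted_axis u v z \<alpha>, u, v]"
  using assms p_orth_left[of u v] p_orth_right[of u v]
  by (auto simp: adapted_axis_def Cayley_triple_def inner_diff_left inner_diff_right inner_commute
      sin_cos_squared_add3 algebra_simps)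

text \<open>
  The vector \<open>z\<close> is the normalised component of \<open>\<plusminus>x\<close> orthogonal to \<open>uv\<close>, with the sign reversed. If
  \<open>\<plusminus>x = uv\<close> this component vanishes, the angle is 0, and any \<open>z\<close> that completes \<open>u, v\<close> will do.
\<close>

lemma adapted_Cayley_triple_exists:
  assumes dim: "DIM('a) = 7" and o: "orthonormal_family [x, u, v]"
  obtains z \<alpha> where "Cayley_triple p (u, v, z)" "\<alpha> \<in> {0..pi/2}"
    "adapted_axis u v z \<alpha> = x \<or> adapted_axis u v z \<alpha> = - x"
proof -
  \<comment> \<open>The sign of the eigenvector is chosen so that the angle lies in the first quadrant.\<close>
  define y where "y = (if x \<bullet> p u v \<ge> 0 then x else - x)"
  define c where "c = y \<bullet> p u v"
  have o': "x \<bullet> x = 1" "x \<bullet> u = 0" "x \<bullet> v = 0" "u \<bullet> u = 1" "u \<bullet> v = 0" "v \<bullet> v = 1"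
    using o by auto
  have uv: "p u v \<bullet> p u v = 1" "u \<bullet> p u v = 0" "v \<bullet> p u v = 0"
    using o' p_norm[of u v] p_orth_left[of u v] p_orth_right[of u v] by (auto simp: inner_commute)
  have y: "y \<bullet> y = 1" "y \<bullet> u = 0" "y \<bullet> v = 0" "c \<ge> 0" "y = x \<or> - y = x"
    using o' by (auto simp: y_def c_def)
  have sq: "(c *\<^sub>R p u v - y) \<bullet> (c *\<^sub>R p u v - y) = 1 - c\<^sup>2"
    using uv y by (simp add: inner_diff_left inner_diff_right c_def[symmetric] inner_commute[of "p u v" y]
        power2_eq_square)
  then have "c\<^sup>2 \<le> 1"
    by (metis diff_ge_0_iff_ge inner_ge_zero)
  then have c1: "c \<le> 1"
    using y(4) by (simp add: power_le_one_iff abs_square_le_1)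
  have \<alpha>: "cos (arccos c) = c" "arccos c \<in> {0..pi/2}" and sin: "sin (arccos c) = sqrt (1 - c\<^sup>2)"
    using y(4) c1 arccos_lbound[of c] arccos_le_pi2[of c]
    by (auto simp: cos_arccos sin_arccos)
  have Cayley: "Cayley_triple p (u, v, z)"
    if "z \<bullet> z = 1" "z \<bullet> u = 0" "z \<bullet> v = 0" "z \<bullet> p u v = 0" for z
    using that o' uv by (auto simp: Cayley_triple_def inner_commute)
  have "\<exists>z. Cayley_triple p (u, v, z) \<and> sqrt (1 - c\<^sup>2) *\<^sub>R z = c *\<^sub>R p u v - y"
  proof (cases "1 - c\<^sup>2 = 0")
    case False
    define r where "r = sqrt (1 - c\<^sup>2)"
    have r: "r > 0" "r * r = 1 - c\<^sup>2"
      using False \<open>c\<^sup>2 \<le> 1\<close> by (simp_all add: r_def)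
    define z where "z = (1 / r) *\<^sub>R (c *\<^sub>R p u v - y)"
    have "Cayley_triple p (u, v, z)"
    proof (rule Cayley)
      have "z \<bullet> z = 1 / r * (1 / r * (1 - c\<^sup>2))"
        by (simp only: z_def inner_scaleR_left inner_scaleR_right sq)
      then show "z \<bullet> z = 1"
        using r(1) by (simp add: r(2)[symmetric])
      show "z \<bullet> u = 0" "z \<bullet> v = 0" "z \<bullet> p u v = 0"
        using y uv by (simp_all add: z_def inner_diff_left inner_diff_right inner_commute c_def)
    qed
    then show ?thesis
      using r by (auto simp: r_def[symmetric] z_def intro!: exI[of _ z])
  next
    case True
    \<comment> \<open>Here \<open>y = uv\<close>, and \<open>z\<close> is taken from the four-dimensional complement of \<open>u, v, uv\<close>.\<close>
    then have "c *\<^sub>R p u v - y = 0"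
      using sq by simp
    have "dim {w. \<forall>a\<in>set [u, v, p u v]. w \<bullet> a = 0} + length [u, v, p u v] = 7"
      unfolding dim[symmetric] using o' uv by (intro dim_orthogonal_complement) simp
    then have "dim {w. \<forall>a\<in>set [u, v, p u v]. w \<bullet> a = 0} \<noteq> 0"
      by simp
    then obtain w where w: "w \<noteq> 0" "w \<bullet> u = 0" "w \<bullet> v = 0" "w \<bullet> p u v = 0"
      by (auto simp: dim_eq_0)
    then have "Cayley_triple p (u, v, w /\<^sub>R norm w)"
      by (intro Cayley) (simp_all add: dot_square_norm power2_eq_square)
    then show ?thesis
      using True \<open>c *\<^sub>R p u v - y = 0\<close> by auto
  qed
  then obtain z where z: "Cayley_triple p (u, v, z)" "sqrt (1 - c\<^sup>2) *\<^sub>R z = c *\<^sub>R p u v - y"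
    by blast
  have "adapted_axis u v z (arccos c) = y"
    unfolding adapted_axis_def \<alpha>(1) sin z(2) by simp
  then show ?thesis
    using that z(1) \<alpha>(2) y(5) by auto
qed

text \<open>
  Both pairs \<open>u, v\<close> and \<open>u', v'\<close> are orthonormal bases of the \<open>\<mu>\<close>-eigenspace, so their products agree up
  to sign. The quadratic form of the common map takes the value \<open>\<nu> + (l - \<nu>) (cos \<alpha>)\<^sup>2\<close> at \<open>uv\<close>, which
  determines \<open>\<alpha>\<close> in the first quadrant.
\<close>

lemma adapted_angle_unique:
  assumes s: "Cayley_triple p (u, v, z)" "Cayley_triple p (u', v', z')"
    and ne: "l \<noteq> \<mu>" "l \<noteq> \<nu>" "\<mu> \<noteq> \<nu>"
    and \<alpha>: "\<alpha> \<in> {0..pi/2}" and \<beta>: "\<beta> \<in> {0..pi/2}"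
    and eq: "spectral_map l \<mu> \<nu> (adapted_axis u v z \<alpha>) u v =
      spectral_map l \<mu> \<nu> (adapted_axis u' v' z' \<beta>) u' v'" (is "?\<delta> = ?\<delta>'")
  shows "\<alpha> = \<beta>"
proof -
  have plane: "{w. spectral_map l \<mu> \<nu> (adapted_axis u v z \<alpha>) u v w = \<mu> *\<^sub>R w} = span {u, v}"
    if "Cayley_triple p (u, v, z)" for u v z \<alpha>
    using spectral_map_eigenspace[OF adapted_axis_orthonormal[OF that] ne, of \<alpha> \<mu>] ne by simp
  have "span {u', v'} = span {u, v}"
    using plane[OF s(1), of \<alpha>] plane[OF s(2), of \<beta>] unfolding eq by simp
  then have mem: "u' \<in> span {u, v}" "v' \<in> span {u, v}"
    by (metis insertI1 span_base, metis insertCI span_base)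
  have rayleigh: "spectral_map l \<mu> \<nu> (adapted_axis u v z \<alpha>) u v (p u v) \<bullet> p u v =
      \<nu> + (l - \<nu>) * (cos \<alpha>)\<^sup>2"
    if "Cayley_triple p (u, v, z)" for u v z \<alpha>
    using that p_orth_left[of u v] p_orth_right[of u v]
    by (simp add: spectral_map_def adapted_axis_def Cayley_triple_def inner_add_left inner_diff_left
        inner_add_right inner_diff_right inner_commute power2_eq_square)
  have pm: "p u' v' = p u v \<or> p u' v' = - p u v"
    using s by (intro p_orthonormal_pair_of_plane mem) (auto simp: Cayley_triple_def)
  have neg: "?\<delta>' (- w) = - ?\<delta>' w" for w
    by (simp add: spectral_map_def)
  from pm have "?\<delta>' (p u' v') \<bullet> p u' v' = ?\<delta>' (p u v) \<bullet> p u v"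
  proof
    assume "p u' v' = - p u v"
    then show ?thesis
      by (simp only: neg inner_minus_left inner_minus_right minus_minus)
  qed simp
  then have "?\<delta>' (p u' v') \<bullet> p u' v' = ?\<delta> (p u v) \<bullet> p u v"
    by (simp only: eq)
  then have "(cos \<beta>)\<^sup>2 = (cos \<alpha>)\<^sup>2"
    using ne by (simp add: rayleigh[OF s(1)] rayleigh[OF s(2)])
  then have "cos \<beta> = cos \<alpha>"
    using \<alpha> \<beta> by (simp add: power2_eq_iff_nonneg cos_ge_zero)
  then show ?thesis
    using \<alpha> \<beta> by (intro cos_inj_pi[of \<alpha> \<beta>]) auto
qed

end

section \<open>The cross-section\<close>

theorem proposition3p3:
  fixes p :: "'a::euclidean_space \<Rightarrow> 'a \<Rightarrow> 'a"
    and s :: "'a \<times> 'a \<times> 'a"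
    and l \<mu> \<nu> :: real
  assumes "DIM('a) = 7"
    and "vector_product p"
    and "Cayley_triple p s"
    and "l \<noteq> \<mu>" and "l \<noteq> \<nu>" and "\<mu> \<noteq> \<nu>"
  shows "cross_section (sym_act p s) (Aut_vp p) (Sym_pairs {(l, 1), (\<mu>, 2), (\<nu>, 4)})
           {block_diag (\<mu> *\<^sub>R mat 1) D (\<nu> *\<^sub>R mat 1) | D \<alpha>.
              D = matrix_inv (rot \<alpha>) ** vector [vector [l, 0], vector [0, \<nu>]] ** rot \<alpha> \<and>
              \<alpha> \<in> {0..pi / 2}}"
proof -
  interpret vector_product_space p
    by unfold_locales (rule assms(2))
  note dim = assms(1) and s = assms(3) and ne = assms(4-6)
  note basis = Cayley_orthonormal_basis[OF dim]
  let ?P = "{(l, 1), (\<mu>, 2), (\<nu>, 4)} :: (real \<times> nat) set"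
  let ?M = "\<lambda>s. matrix_wrt (Cayley_basis p s)"
  define N where "N \<alpha> = block_diag (\<mu> *\<^sub>R mat 1)
      (matrix_inv (rot \<alpha>) ** vector [vector [l, 0], vector [0, \<nu>]] ** rot \<alpha>) (\<nu> *\<^sub>R mat 1)" for \<alpha>
  let ?S = "\<lambda>u v z \<alpha>. spectral_map l \<mu> \<nu> (adapted_axis u v z \<alpha>) u v"
  have N: "?M (u, v, z) (?S u v z \<alpha>) = N \<alpha>" if "Cayley_triple p (u, v, z)" for u v z \<alpha>
    using matrix_wrt_spectral_map[OF basis[OF that], of l \<mu> \<nu> \<alpha>]
    by (simp add: N_def adapted_axis_def Cayley_basis_def vector_7)
  have pairs: "eigen_pairs A = ?P \<longleftrightarrow>
      (\<forall>t. dim (eigenspace A t) = (if t = l then 1 else if t = \<mu> then 2 else if t = \<nu> then 4 else 0))"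
    for A :: "real ^ 7 ^ 7"
    by (rule eigen_pairs_iff) (use ne in auto)
  have Sym: "?M s \<delta> \<in> Sym_mat" if "\<delta> \<in> Sym_end" for \<delta>
    using that by (simp add: Sym_mat_def Sym_end_def transpose_def vec_eq_iff
        matrix_wrt_nth[OF basis[OF s]] inner_commute)
  have N_Sym_pairs: "N \<alpha> \<in> Sym_pairs ?P" for \<alpha>
  proof -
    obtain u v z where uvz: "s = (u, v, z)"
      by (metis prod.exhaust)
    have on: "orthonormal_family [adapted_axis u v z \<alpha>, u, v]"
      using adapted_axis_orthonormal s uvz by blast
    have lin: "linear (?S u v z \<alpha>)"
      using spectral_map_Sym_end unfolding Sym_end_def by blast
    have M: "?M s (?S u v z \<alpha>) = N \<alpha>"
      unfolding uvz by (rule N[OF s[unfolded uvz]])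
    have "eigen_pairs (?M s (?S u v z \<alpha>)) = ?P"
      unfolding pairs dim_eigenspace_matrix_wrt[OF basis[OF s] lin] spectral_map_dim[OF on ne]
      using dim by simp
    then show ?thesis
      using M Sym[OF spectral_map_Sym_end[of l \<mu> \<nu> "adapted_axis u v z \<alpha>" u v]]
      by (simp add: Sym_pairs_def)
  qed
  have "\<exists>!c. c \<in> N ` {0..pi/2} \<and> c \<in> orbit_of (sym_act p s) (Aut_vp p) A"
    if A: "A \<in> Sym_pairs ?P" for A
  proof -
    obtain \<delta> where \<delta>: "\<delta> \<in> Sym_end" "?M s \<delta> = A"
      using A Sym_mat_matrix_wrtE[OF basis[OF s]] by (auto simp: Sym_pairs_def)
    have lin: "linear \<delta>"
      using \<delta>(1) by (simp add: Sym_end_def)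
    have orbit: "orbit_of (sym_act p s) (Aut_vp p) A = {?M s' \<delta> | s'. Cayley_triple p s'}"
      using orbit_sym_act[OF dim s \<delta>(1)] \<delta>(2) by simp
    have dims: "dim {w. \<delta> w = t *\<^sub>R w} =
        (if t = l then 1 else if t = \<mu> then 2 else if t = \<nu> then 4 else 0)" for t
      using A pairs[of A] dim_eigenspace_matrix_wrt[OF basis[OF s] lin, of t] \<delta>(2)
      by (simp add: Sym_pairs_def)
    obtain x u v where xuv: "orthonormal_family [x, u, v]" "\<delta> = spectral_map l \<mu> \<nu> x u v"
      by (rule spectral_map_exists[OF \<delta>(1) ne]) (use dims ne dim in auto)
    obtain z \<alpha> where z: "Cayley_triple p (u, v, z)" and \<alpha>: "\<alpha> \<in> {0..pi/2}"
      and axis: "adapted_axis u v z \<alpha> = x \<or> adapted_axis u v z \<alpha> = - x"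
      by (rule adapted_Cayley_triple_exists[OF dim xuv(1)])
    have \<delta>S: "\<delta> = ?S u v z \<alpha>"
      using axis xuv(2) by (auto simp: spectral_map_uminus)
    show ?thesis
    proof (rule ex1I[of _ "N \<alpha>"])
      show "N \<alpha> \<in> N ` {0..pi/2} \<and> N \<alpha> \<in> orbit_of (sym_act p s) (Aut_vp p) A"
        unfolding orbit using \<alpha> z N[OF z, of \<alpha>, folded \<delta>S, symmetric] by blast
    next
      fix c assume "c \<in> N ` {0..pi/2} \<and> c \<in> orbit_of (sym_act p s) (Aut_vp p) A"
      then obtain \<beta> u' v' z' where \<beta>: "\<beta> \<in> {0..pi/2}" "c = N \<beta>"
        and z': "Cayley_triple p (u', v', z')" and c: "?M (u', v', z') \<delta> = N \<beta>"
        unfolding orbit by auto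
      have "?M (u', v', z') \<delta> = ?M (u', v', z') (?S u' v' z' \<beta>)"
        using c N[OF z'] by simp
      then have "\<delta> = ?S u' v' z' \<beta>"
        by (rule inj_onD[OF matrix_wrt_inj_on[OF basis[OF z']] _ \<delta>(1) spectral_map_Sym_end])
      then have "\<alpha> = \<beta>"
        using adapted_angle_unique[OF z z' ne \<alpha> \<beta>(1)] \<delta>S by simp
      then show "c = N \<alpha>"
        using \<beta>(2) by simp
    qed
  qed
  moreover have "{block_diag (\<mu> *\<^sub>R mat 1) D (\<nu> *\<^sub>R mat 1) | D \<alpha>.
              D = matrix_inv (rot \<alpha>) ** vector [vector [l, 0], vector [0, \<nu>]] ** rot \<alpha> \<and>
              \<alpha> \<in> {0..pi / 2}} = N ` {0..pi/2}"
    unfolding N_def image_def by blast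
  ultimately show ?thesis
    using N_Sym_pairs by (auto simp: cross_section_def)
qed

end
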